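(* Let $n\ge 1$, let $\mathcal{D}$ be a probability distribution on $n\times n$ complex matrices, and let $\tau>0$. Then $$\mathbb{E}_{M\sim\mathcal{D}}\,\rho(M)^2\ \le\ \tau^2\cdot \mathbb{E}_{\theta\sim[0,2\pi]}\,\mathbb{E}_{M\sim\mathcal{D}}\left|\det\left(I-\frac{e^{\mathrm{i}\theta}}{\tau}\cdot M\right)\right|^2 .$$
   Context: $\rho(M)=\max\{|\lambda| : \lambda \text{ an eigenvalue of } M\}$ is the spectral radius. $I$ is the $n\times n$ identity matrix, $\mathrm{i}$ is the imaginary unit, and $\theta\sim[0,2\pi]$ means $\theta$ is uniform on $[0,2\pi]$. Expectations of nonnegative quantities take values in $[0,\infty]$. *)

theory Defs
  imports
    "HOL-Probability.Probability"
    "Jordan_Normal_Form.Spectral_Radius"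
begin

(* Both HOL-Analysis and Jordan_Normal_Form declare a constant det; the one for matrices of
   type 'a mat is the constant Determinant.det. *)

(* There is no type-class Borel sigma-algebra on complex mat, since this type contains
   matrices of all dimensions.  This is the Borel sigma-algebra of the n x n complex matrices,
   identified with complex n^2-space: the coarsest one for which all entries are
   Borel measurable. *)
definition borel_mat :: "nat \<Rightarrow> complex mat measure" where
  "borel_mat n = vimage_algebra (carrier_mat n n)
     (\<lambda>A. \<lambda>ij\<in>{..<n} \<times> {..<n}. A $$ ij)
     (\<Pi>\<^sub>M ij\<in>{..<n} \<times> {..<n}. borel)"

lemma space_borel_mat [simp]: "space (borel_mat n) = carrier_mat n n"
  by (simp add: borel_mat_def)

lemma measurable_entry_borel_mat [measurable]:
  assumes "i < n" "j < n"
  shows "(\<lambda>A. A $$ (i, j)) \<in> borel_measurable (borel_mat n)"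
proof -
  let ?f = "\<lambda>A::complex mat. \<lambda>ij\<in>{..<n} \<times> {..<n}. A $$ ij"
  have "?f \<in> borel_mat n \<rightarrow>\<^sub>M (\<Pi>\<^sub>M ij\<in>{..<n} \<times> {..<n}. borel)"
    unfolding borel_mat_def
    by (rule measurable_vimage_algebra1) (auto simp: space_PiM)
  then have "(\<lambda>A. ?f A (i, j)) \<in> borel_measurable (borel_mat n)"
    by (rule measurable_compose[OF _ measurable_component_singleton]) (use assms in auto)
  then show ?thesis
    using assms by simp
qed

end

theory Submission
  imports Defs
begin

text \<open>
  If \<open>a\<close> is an eigenvalue of \<open>M\<close> of maximal modulus and \<open>u = a / \<tau>\<close>, then
  \<open>det (I - (z / \<tau>) M) = (1 - z u) q(z)\<close> with \<open>q(0) = 1\<close>. On the unit circle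
  \<open>\<bar>1 - z u\<bar> = \<bar>z - cnj u\<bar>\<close>, so the determinant has the same mean square there as the polynomial
  \<open>(z - cnj u) q(z)\<close>, whose constant coefficient has modulus \<open>\<bar>u\<bar> = \<rho>(M) / \<tau>\<close>; and the mean
  square of a polynomial on the unit circle is at least \<open>\<bar>h(0)\<bar>\<^sup>2\<close>. It remains to integrate over \<open>M\<close>
  and to exchange the two integrals.
\<close>

text \<open>For \<open>k > 0\<close> the integrand has the antiderivative
  \<open>exp (i * z) ^ k / (k * i)\<close>, which takes the same value at both ends of a full
  turn.\<close>

lemma has_integral_exp_circle:
  fixes k :: nat
  assumes "k > 0"
  shows "((\<lambda>\<theta>. exp (\<i> * complex_of_real \<theta>) ^ k) has_integral 0) {0..2 * pi}"
proof -
  let ?F = "\<lambda>z. exp (\<i> * z) ^ k / (of_nat k * \<i>)"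
  have "((\<lambda>x. ?F (complex_of_real x)) has_vector_derivative exp (\<i> * complex_of_real \<theta>) ^ k)
      (at \<theta> within {0..2 * pi})" for \<theta>
  proof (rule has_vector_derivative_real_field)
    let ?z = "complex_of_real \<theta>"
    have "(?F has_field_derivative
        of_nat k * (exp (\<i> * ?z) * \<i>) * exp (\<i> * ?z) ^ (k - 1) / (of_nat k * \<i>)) (at ?z)"
      by (intro DERIV_cdivide) (auto intro!: derivative_eq_intros)
    also have "of_nat k * (exp (\<i> * ?z) * \<i>) * exp (\<i> * ?z) ^ (k - 1) / (of_nat k * \<i>) =
        exp (\<i> * ?z) ^ (k - 1) * exp (\<i> * ?z)"
      using assms by (simp add: mult_ac)
    also have "\<dots> = exp (\<i> * ?z) ^ k"
      using assms by (rule power_minus_mult)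
    finally show "(?F has_field_derivative exp (\<i> * ?z) ^ k) (at ?z)" .
  qed
  then have "((\<lambda>\<theta>. exp (\<i> * complex_of_real \<theta>) ^ k) has_integral
      ?F (complex_of_real (2 * pi)) - ?F (complex_of_real 0)) {0..2 * pi}"
    by (intro fundamental_theorem_of_calculus) auto
  moreover have "exp (\<i> * complex_of_real (2 * pi)) = 1"
    by (simp add: mult.commute[of 2])
  ultimately show ?thesis
    by simp
qed

text \<open>The mean value property at 0: integrating term by term, every positive power averages
  out over the circle.\<close>

lemma has_integral_poly_circle:
  "((\<lambda>\<theta>. poly h (exp (\<i> * complex_of_real \<theta>))) has_integral
      complex_of_real (2 * pi) * coeff h 0) {0..2 * pi}"
proof -
  let ?e = "\<lambda>\<theta>. exp (\<i> * complex_of_real \<theta>)"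
  have "((\<lambda>\<theta>. coeff h k * ?e \<theta> ^ k) has_integral
      (if k = 0 then complex_of_real (2 * pi) * coeff h 0 else 0)) {0..2 * pi}" for k
  proof (cases "k = 0")
    case True
    then show ?thesis
      using has_integral_const_real[of "coeff h 0" 0 "2 * pi"] by (simp add: scaleR_conv_of_real)
  next
    case False
    then show ?thesis
      using has_integral_mult_right[OF has_integral_exp_circle[of k], of "coeff h k"] by simp
  qed
  then have "((\<lambda>\<theta>. \<Sum>k\<le>degree h. coeff h k * ?e \<theta> ^ k) has_integral
      (\<Sum>k\<le>degree h. if k = 0 then complex_of_real (2 * pi) * coeff h 0 else 0)) {0..2 * pi}"
    by (intro has_integral_sum) auto
  then show ?thesis
    by (simp add: poly_altdef)
qed

text \<open>Links the \<open>ennreal\<close> expectation in the theorem to the gauge integral in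
  which the circle integrals are evaluated.\<close>

lemma nn_integral_uniform_Icc:
  fixes f :: "real \<Rightarrow> real"
  assumes "a < b" and cont: "continuous_on UNIV f" and nonneg: "\<And>x. 0 \<le> f x"
  shows "(\<integral>\<^sup>+ x. ennreal (f x) \<partial>uniform_measure lborel {a..b}) =
    ennreal (integral {a..b} f / (b - a))"
proof -
  have [measurable]: "f \<in> borel_measurable borel"
    using cont by (rule borel_measurable_continuous_onI)
  let ?g = "\<lambda>x. if x \<in> {a..b} then f x else 0"
  have "f integrable_on {a..b}"
    by (intro integrable_continuous_real continuous_on_subset[OF cont]) auto
  then have "(?g has_integral integral {a..b} f) UNIV"
    unfolding has_integral_restrict_UNIV by (rule integrable_integral)
  then have "(\<integral>\<^sup>+ x. ennreal (?g x) \<partial>lborel) = ennreal (integral {a..b} f)"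
    by (intro nn_integral_has_integral_lborel) (use nonneg in auto)
  moreover have "ennreal (f x) * indicator {a..b} x = ennreal (?g x)" for x
    by simp
  moreover have "0 \<le> integral {a..b} f"
    using nonneg by (intro integral_nonneg \<open>f integrable_on {a..b}\<close>) auto
  ultimately show ?thesis
    using \<open>a < b\<close> by (simp add: nn_integral_uniform_measure divide_ennreal)
qed

text \<open>With \<open>a\<close> the constant coefficient and \<open>p\<close> the value on the
  circle, expanding \<open>|p - a|^2\<close> and using that it is nonnegative gives
  \<open>2 Re (cnj a * p) - |a|^2\<close> as a lower bound of \<open>|p|^2\<close>. This bound is
  affine in \<open>p\<close>, so the mean value property evaluates its average,
  \<open>2 |a|^2 - |a|^2 = |a|^2\<close>. This stands in for Parseval's identity.\<close>

lemma cmod_coeff_0_le_circle_mean: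
  "ennreal ((cmod (coeff h 0))\<^sup>2) \<le>
    (\<integral>\<^sup>+ \<theta>. ennreal ((cmod (poly h (exp (\<i> * complex_of_real \<theta>))))\<^sup>2)
      \<partial>uniform_measure lborel {0..2 * pi})"
proof -
  let ?a = "coeff h 0" and ?p = "\<lambda>\<theta>. poly h (exp (\<i> * complex_of_real \<theta>))"
  let ?f = "\<lambda>\<theta>. (cmod (?p \<theta>))\<^sup>2"
  have cont: "continuous_on A ?f" for A
    by (intro continuous_intros)
  have "((\<lambda>\<theta>. Re (cnj ?a * ?p \<theta>)) has_integral Re (cnj ?a * (complex_of_real (2 * pi) * ?a))) {0..2 * pi}"
    by (intro has_integral_Re has_integral_mult_right has_integral_poly_circle)
  also have "Re (cnj ?a * (complex_of_real (2 * pi) * ?a)) = 2 * pi * (cmod ?a)\<^sup>2"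
    unfolding cmod_power2 by (simp add: power2_eq_square algebra_simps)
  finally have "((\<lambda>\<theta>. 2 * Re (cnj ?a * ?p \<theta>) - (cmod ?a)\<^sup>2) has_integral
      2 * (2 * pi * (cmod ?a)\<^sup>2) - 2 * pi * (cmod ?a)\<^sup>2) {0..2 * pi}"
    using has_integral_const_real[of "(cmod ?a)\<^sup>2" 0 "2 * pi"]
    by (intro has_integral_diff has_integral_mult_right) auto
  moreover have "(?f has_integral integral {0..2 * pi} ?f) {0..2 * pi}"
    by (intro integrable_integral integrable_continuous_real cont)
  moreover have "2 * Re (cnj ?a * ?p \<theta>) - (cmod ?a)\<^sup>2 \<le> ?f \<theta>" for \<theta>
  proof -
    have "0 \<le> (cmod (?p \<theta> - ?a))\<^sup>2"
      by simp
    then show ?thesis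
      unfolding cmod_power2 by (simp add: power2_eq_square algebra_simps)
  qed
  ultimately have "2 * (2 * pi * (cmod ?a)\<^sup>2) - 2 * pi * (cmod ?a)\<^sup>2 \<le> integral {0..2 * pi} ?f"
    by (rule has_integral_le)
  then have "(cmod ?a)\<^sup>2 \<le> integral {0..2 * pi} ?f / (2 * pi - 0)"
    by (simp add: field_simps)
  then show ?thesis
    by (subst nn_integral_uniform_Icc) (auto intro!: ennreal_leI cont)
qed

lemma det_one_minus_smult:
  fixes M :: "complex mat"
  assumes M: "M \<in> carrier_mat n n"
    and as: "char_poly M = (\<Prod>a\<leftarrow>as. [:- a, 1:])" "length as = n"
    and "c \<noteq> 0"
  shows "Determinant.det (1\<^sub>m n - c \<cdot>\<^sub>m M) = (\<Prod>a\<leftarrow>as. 1 - c * a)"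
proof -
  \<comment> \<open>\<open>char_matrix M e\<close> is \<open>M - e I\<close>, hence the negation.
    Pulling \<open>c\<close> out of all \<open>n\<close> rows leaves the characteristic polynomial
    at \<open>inverse c\<close>; the power \<open>c ^ n\<close> is then shared out among the
    \<open>n\<close> linear factors.\<close>
  have "1\<^sub>m n - c \<cdot>\<^sub>m M = c \<cdot>\<^sub>m (- char_matrix M (inverse c))"
    using M \<open>c \<noteq> 0\<close> by (intro eq_matI) (auto simp: char_matrix_def algebra_simps)
  then have "Determinant.det (1\<^sub>m n - c \<cdot>\<^sub>m M) = c ^ n * poly (char_poly M) (inverse c)"
    using M by (simp add: char_poly_matrix[OF M] char_matrix_def)
  also have "\<dots> = c ^ length as * (\<Prod>a\<leftarrow>as. inverse c - a)"
    unfolding as(2) as(1) by (simp add: poly_prod_list o_def)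
  also have "\<dots> = (\<Prod>a\<leftarrow>as. 1 - c * a)"
    using \<open>c \<noteq> 0\<close> by (induction as) (auto simp: field_simps)
  finally show ?thesis .
qed

text \<open>Writing 1 as \<open>z * cnj z\<close> lets the unimodular \<open>z\<close> be factored
  out, and conjugation keeps the modulus. The effect is to move \<open>u\<close> from the leading
  into the constant coefficient.\<close>

lemma cmod_one_minus_circle:
  assumes "cmod z = 1"
  shows "cmod (1 - z * u) = cmod (z - cnj u)"
proof -
  have "z * cnj z = 1"
    using assms by (simp add: complex_norm_square[symmetric])
  then have "1 - z * u = z * cnj (z - cnj u)"
    by (simp add: algebra_simps)
  then show ?thesis
    using assms by (simp add: norm_mult del: complex_cnj_diff)
qed

lemma spectral_radius_le_circle_mean:
  assumes M: "M \<in> carrier_mat n n" and "n > 0" "\<tau> > 0"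
  shows "ennreal ((spectral_radius M)\<^sup>2) \<le> ennreal (\<tau>\<^sup>2) *
    (\<integral>\<^sup>+ \<theta>. ennreal ((cmod (Determinant.det
        (1\<^sub>m n - (exp (\<i> * complex_of_real \<theta>) / complex_of_real \<tau>) \<cdot>\<^sub>m M)))\<^sup>2)
      \<partial>uniform_measure lborel {0..2 * pi})"
proof -
  obtain as where as: "char_poly M = (\<Prod>a\<leftarrow>as. [:- a, 1:])" "length as = n"
    using char_poly_factorized[OF M] by auto
  obtain a where a: "a \<in> spectrum M" "spectral_radius M = cmod a"
    using spectral_radius_mem_max(1)[OF M \<open>n > 0\<close>] by auto
  then have "poly (char_poly M) a = 0"
    using spectrum_root_char_poly[OF M] by auto
  then have "a \<in> set as"
    by (auto simp: as(1) poly_prod_list prod_list_zero_iff)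
  \<comment> \<open>\<open>remove1\<close> drops a single occurrence of \<open>a\<close>, so
    \<open>q\<close> keeps the factors of its remaining multiplicity.\<close>
  define u q where "u = a / complex_of_real \<tau>"
    and "q = (\<Prod>b\<leftarrow>remove1 a as. [:1, - (b / complex_of_real \<tau>):])"
  have coeff_q: "coeff q 0 = 1"
    unfolding q_def poly_0_coeff_0[symmetric] poly_prod_list by (simp add: o_def map_replicate_const)
  have det_eq: "cmod (Determinant.det
        (1\<^sub>m n - (exp (\<i> * complex_of_real \<theta>) / complex_of_real \<tau>) \<cdot>\<^sub>m M)) =
      cmod (poly ([:- cnj u, 1:] * q) (exp (\<i> * complex_of_real \<theta>)))" for \<theta>
  proof -
    define z where "z = exp (\<i> * complex_of_real \<theta>)"
    have z: "cmod z = 1"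
      by (simp add: z_def)
    have "Determinant.det (1\<^sub>m n - (z / complex_of_real \<tau>) \<cdot>\<^sub>m M) =
        (\<Prod>b\<leftarrow>as. 1 - z / complex_of_real \<tau> * b)"
      using \<open>\<tau> > 0\<close> by (intro det_one_minus_smult[OF M as]) (auto simp: z_def)
    also have "\<dots> = (1 - z * u) * poly q z"
      using prod_list_map_remove1[OF \<open>a \<in> set as\<close>, of "\<lambda>b. 1 - z / complex_of_real \<tau> * b"]
      by (simp add: u_def q_def poly_prod_list o_def)
    finally show ?thesis
      unfolding z_def[symmetric] poly_mult norm_mult
      by (simp add: norm_mult cmod_one_minus_circle[OF z])
  qed
  \<comment> \<open>The constant coefficient is \<open>- cnj u\<close> because that of
    \<open>q\<close> is 1; its modulus is \<open>spectral_radius M\<close> divided by \<tau>, which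
    the factor in front undoes.\<close>
  have "ennreal ((spectral_radius M)\<^sup>2) =
      ennreal (\<tau>\<^sup>2) * ennreal ((cmod (coeff ([:- cnj u, 1:] * q) 0))\<^sup>2)"
    using \<open>\<tau> > 0\<close>
    by (simp add: a(2) u_def coeff_mult coeff_q norm_divide power_divide flip: ennreal_mult')
  also have "\<dots> \<le> ennreal (\<tau>\<^sup>2) *
      (\<integral>\<^sup>+ \<theta>. ennreal ((cmod (poly ([:- cnj u, 1:] * q) (exp (\<i> * complex_of_real \<theta>))))\<^sup>2)
        \<partial>uniform_measure lborel {0..2 * pi})"
    by (intro mult_left_mono cmod_coeff_0_le_circle_mean) auto
  finally show ?thesis
    unfolding det_eq .
qed

text \<open>Joint measurability for the exchange of the integrals. By the Leibniz formula the
  determinant is a polynomial in \<open>c\<close> and the matrix entries, and the entries are what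
  \<open>borel_mat\<close> makes measurable.\<close>

lemma measurable_det_one_minus:
  assumes [measurable_cong]: "sets D = sets (borel_mat n)"
    and [measurable]: "c \<in> borel_measurable N"
  shows "(\<lambda>(M, \<theta>). Determinant.det (1\<^sub>m n - c \<theta> \<cdot>\<^sub>m M)) \<in> borel_measurable (D \<Otimes>\<^sub>M N)"
proof -
  have space_D: "space D = carrier_mat n n"
    using sets_eq_imp_space_eq[OF assms(1)] by simp
  have "(\<lambda>x. \<Sum>p | p permutes {0..<n}. signof p *
      (\<Prod>i = 0..<n. (1\<^sub>m n :: complex mat) $$ (i, p i) - c (snd x) * fst x $$ (i, p i)))
    \<in> borel_measurable (D \<Otimes>\<^sub>M N)"
  proof (intro borel_measurable_sum borel_measurable_times borel_measurable_const
      borel_measurable_prod borel_measurable_diff)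
    fix p i
    assume "p \<in> {p. p permutes {0..<n}}" "i \<in> {0..<n}"
    then have "i < n" "p i < n"
      using permutes_in_image[of p "{0..<n}" i] by auto
    then have [measurable]: "(\<lambda>M. M $$ (i, p i)) \<in> borel_measurable D"
      by measurable
    show "(\<lambda>x. fst x $$ (i, p i)) \<in> borel_measurable (D \<Otimes>\<^sub>M N)"
      by measurable
    show "(\<lambda>x. c (snd x)) \<in> borel_measurable (D \<Otimes>\<^sub>M N)"
      by measurable
  qed
  \<comment> \<open>The expansion refers to the dimension \<open>n\<close>, so the two functions are
    compared on the space of the product, where the first component is an n x n matrix.\<close>
  moreover have "(case x of (M, \<theta>) \<Rightarrow> Determinant.det (1\<^sub>m n - c \<theta> \<cdot>\<^sub>m M)) =
      (\<Sum>p | p permutes {0..<n}. signof p *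
        (\<Prod>i = 0..<n. (1\<^sub>m n :: complex mat) $$ (i, p i) - c (snd x) * fst x $$ (i, p i)))"
    if "x \<in> space (D \<Otimes>\<^sub>M N)" for x
  proof -
    obtain M \<theta> where x: "x = (M, \<theta>)" "M \<in> carrier_mat n n"
      using \<open>x \<in> space (D \<Otimes>\<^sub>M N)\<close> by (auto simp: space_pair_measure space_D)
    have "p i < n" if "p permutes {0..<n}" "i < n" for p i
      using permutes_in_image[of p "{0..<n}" i] that by auto
    moreover have "1\<^sub>m n - c \<theta> \<cdot>\<^sub>m M \<in> carrier_mat n n"
      using x(2) by auto
    ultimately show ?thesis
      using x by (auto simp: det_def' intro!: sum.cong prod.cong)
  qed
  ultimately show ?thesis
    by (subst measurable_cong)
qed

theorem corollary1p2:
  fixes n :: nat and D :: "complex mat measure" and \<tau> :: real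
  assumes "n \<ge> 1"
    and "prob_space D"
    and "sets D = sets (borel_mat n)"
    and "\<tau> > 0"
  shows "(\<integral>\<^sup>+ M. ennreal ((spectral_radius M)\<^sup>2) \<partial>D)
    \<le> ennreal (\<tau>\<^sup>2) *
      (\<integral>\<^sup>+ \<theta>. (\<integral>\<^sup>+ M. ennreal
          ((cmod (Determinant.det
            (1\<^sub>m n - (exp (\<i> * complex_of_real \<theta>) / complex_of_real \<tau>) \<cdot>\<^sub>m M)))\<^sup>2) \<partial>D)
        \<partial>(uniform_measure lborel {0..2 * pi}))"
proof -
  define U where "U = uniform_measure lborel {0..2 * pi}"
  define f where "f M \<theta> = ennreal ((cmod (Determinant.det
    (1\<^sub>m n - (exp (\<i> * complex_of_real \<theta>) / complex_of_real \<tau>) \<cdot>\<^sub>m M)))\<^sup>2)" for M \<theta>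
  interpret D: prob_space D
    by fact
  interpret U: prob_space U
    unfolding U_def by (rule prob_space_uniform_measure) auto
  interpret pair_sigma_finite D U ..
  have [measurable_cong]: "sets U = sets borel"
    by (simp add: U_def)
  have "(\<lambda>\<theta>. exp (\<i> * complex_of_real \<theta>) / complex_of_real \<tau>) \<in> borel_measurable U"
    by measurable
  note [measurable] = measurable_det_one_minus[OF assms(3) this, unfolded case_prod_beta]
  have f [measurable]: "case_prod f \<in> borel_measurable (D \<Otimes>\<^sub>M U)"
    unfolding f_def case_prod_beta by measurable
  \<comment> \<open>\<open>nn_integral\<close> is a supremum over simple functions below the
    integrand, hence monotone for arbitrary functions, \<open>spectral_radius\<close>
    included.\<close>
  have "(\<integral>\<^sup>+ M. ennreal ((spectral_radius M)\<^sup>2) \<partial>D) \<le>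
      (\<integral>\<^sup>+ M. ennreal (\<tau>\<^sup>2) * (\<integral>\<^sup>+ \<theta>. f M \<theta> \<partial>U) \<partial>D)"
  proof (rule nn_integral_mono)
    fix M
    assume "M \<in> space D"
    then have "M \<in> carrier_mat n n"
      using sets_eq_imp_space_eq[OF assms(3)] by simp
    then show "ennreal ((spectral_radius M)\<^sup>2) \<le> ennreal (\<tau>\<^sup>2) * (\<integral>\<^sup>+ \<theta>. f M \<theta> \<partial>U)"
      unfolding f_def U_def using assms by (intro spectral_radius_le_circle_mean) auto
  qed
  also have "\<dots> = ennreal (\<tau>\<^sup>2) * (\<integral>\<^sup>+ M. (\<integral>\<^sup>+ \<theta>. f M \<theta> \<partial>U) \<partial>D)"
    by (rule nn_integral_cmult) measurable
  \<comment> \<open>Tonelli: the integrand is nonnegative and jointly measurable, and both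
    probability measures are sigma-finite.\<close>
  also have "(\<integral>\<^sup>+ M. (\<integral>\<^sup>+ \<theta>. f M \<theta> \<partial>U) \<partial>D) = (\<integral>\<^sup>+ \<theta>. (\<integral>\<^sup>+ M. f M \<theta> \<partial>D) \<partial>U)"
    by (rule Fubini'[symmetric]) (rule f)
  finally show ?thesis
    unfolding f_def U_def .
qed

end
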